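(* Let $n\ge 1$, $q\ge 2$, $d$ and $s$ be integers with $0\leq d\leq n$, $s\ge 0$ and $d+s\leq n$. Let $\mathcal{V}\subseteq \{0,1,\ldots,q-1\}^n$ be a $d$-Hamming tuple system that shatters no subset of $[n]$ of size $s+1$. Then $$|\mathcal{V}|\leq {n\choose s} \sum_{i=0}^d {n-s \choose i}(q-2)^i.$$
   Context: $[n]=\{1,\ldots,n\}$ and $(q)=\{0,1,\ldots,q-1\}$. A tuple $\mathbf v\in(q)^n$ is viewed as a function $[n]\to(q)$. $\mathcal{V}\subseteq(q)^n$ shatters $S\subseteq[n]$ if $\{\mathbf v|_S:\mathbf v\in\mathcal V\}$ is the set of all functions $S\to (q)$. $\mathcal V$ is $d$-Hamming if $|\{i\in[n]: v_i\neq 0\}|=d$ for every $(v_1,\ldots,v_n)\in\mathcal V$. Convention: $0^0=1$. *)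

theory Defs
  imports Complex_Main "HOL-Library.FuncSet"
begin

text \<open>A tuple of length \<open>n\<close> over \<open>{0, \<dots>, q - 1}\<close> is an extensional function on \<open>{1..n}\<close>
  (value \<open>undefined\<close> outside), so that restriction and equality of tuples are the intended ones.\<close>

definition tuples :: "nat \<Rightarrow> nat \<Rightarrow> (nat \<Rightarrow> nat) set" where
  "tuples q n = {1..n} \<rightarrow>\<^sub>E {0..<q}"

definition shatters :: "nat \<Rightarrow> (nat \<Rightarrow> nat) set \<Rightarrow> nat set \<Rightarrow> bool" where
  "shatters q V S \<longleftrightarrow> (\<lambda>v. restrict v S) ` V = (S \<rightarrow>\<^sub>E {0..<q})"

definition hamming_system :: "nat \<Rightarrow> nat \<Rightarrow> (nat \<Rightarrow> nat) set \<Rightarrow> bool" where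
  "hamming_system n d V \<longleftrightarrow> (\<forall>v\<in>V. card {i \<in> {1..n}. v i \<noteq> 0} = d)"

end

theory Submission
  imports Defs "HOL-Library.Function_Algebras"
begin

text \<open>
  Linear algebra in the real functions on \<open>V\<close>. On a single coordinate use the basis consisting of
  \<open>1\<close>, the indicator \<open>z = [x = 0]\<close> and the \<open>q - 2\<close> functions \<open>[x = k] - [x = q - 1]\<close>,
  \<open>0 < k < q - 1\<close>, and on tuples the resulting product monomials. A monomial with a factor \<open>z\<close> in
  more than \<open>s\<close> coordinates reduces on \<open>V\<close> to monomials with fewer such factors, because some pattern on
  \<open>s + 1\<close> of these coordinates is missing. If \<open>z\<close> occurs in \<open>t < s\<close> coordinates, then multiplying the
  monomial by the sum of \<open>z\<close> over the coordinates it does not involve amounts on \<open>V\<close> to multiplying it by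
  \<open>n - d - t > 0\<close>, so it is a combination of monomials with one more factor \<open>z\<close>. A monomial with
  more than \<open>d\<close> factors \<open>[x = k] - [x = q - 1]\<close> vanishes on \<open>V\<close>. Hence the functions on \<open>V\<close> are
  spanned by the monomials with exactly \<open>s\<close> factors \<open>z\<close> and at most \<open>d\<close> factors of the
  last kind, and the bound is the number of these.
\<close>

section \<open>Spans of real functions and a dimension bound\<close>

interpretation fun_space: vector_space "\<lambda>(c::real) (f::'a \<Rightarrow> real) x. c * f x"
  by unfold_locales (auto simp: algebra_simps fun_eq_iff)

lemma sum_fun_apply:
  fixes f :: "'b \<Rightarrow> 'a \<Rightarrow> real"
  shows "(\<Sum>w\<in>W. f w) x = (\<Sum>w\<in>W. f w x)"
  by (induction W rule: infinite_finite_induct) (auto simp: zero_fun_def plus_fun_def)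

text \<open>Span membership modulo functions vanishing on \<open>V\<close>. Coefficients are indexed
  by \<open>W\<close>, so coincidences among the \<open>F w\<close> do no harm.\<close>

definition spanned_on :: "'a set \<Rightarrow> ('w \<Rightarrow> 'a \<Rightarrow> real) \<Rightarrow> 'w set \<Rightarrow> ('a \<Rightarrow> real) \<Rightarrow> bool" where
  "spanned_on V F W f \<longleftrightarrow> (\<exists>c. \<forall>v\<in>V. f v = (\<Sum>w\<in>W. c w * F w v))"

lemma spanned_on_cong:
  assumes "spanned_on V F W g" "\<And>v. v \<in> V \<Longrightarrow> f v = g v"
  shows "spanned_on V F W f"
  using assms unfolding spanned_on_def by simp

lemma spanned_on_base:
  assumes "finite W" "w \<in> W"
  shows "spanned_on V F W (F w)"
  unfolding spanned_on_def
  by (rule exI[of _ "\<lambda>x. of_bool (x = w)"]) (use assms in simp)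

text \<open>Exempting zero coefficients matters in \<open>mon_spanned_reduce\<close>, where only
  monomials with \<open>C r \<noteq> 0\<close> are known to be smaller.\<close>

lemma spanned_on_sum:
  assumes "\<And>i. i \<in> I \<Longrightarrow> a i \<noteq> 0 \<Longrightarrow> spanned_on V F W (g i)"
  shows "spanned_on V F W (\<lambda>v. \<Sum>i\<in>I. a i * g i v)"
proof -
  have "\<forall>i. \<exists>c. i \<in> I \<longrightarrow> a i \<noteq> 0 \<longrightarrow> (\<forall>v\<in>V. g i v = (\<Sum>w\<in>W. c w * F w v))"
    using assms unfolding spanned_on_def by blast
  from choice[OF this] obtain c where c: "\<And>i v. i \<in> I \<Longrightarrow> a i \<noteq> 0 \<Longrightarrow> v \<in> V \<Longrightarrow> g i v = (\<Sum>w\<in>W. c i w * F w v)"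
    by blast
  have "(\<Sum>i\<in>I. a i * g i v) = (\<Sum>w\<in>W. (\<Sum>i\<in>I. a i * c i w) * F w v)" if "v \<in> V" for v
  proof -
    have "(\<Sum>i\<in>I. a i * g i v) = (\<Sum>i\<in>I. a i * (\<Sum>w\<in>W. c i w * F w v))"
      using c that by (intro sum.cong) auto
    also have "\<dots> = (\<Sum>i\<in>I. \<Sum>w\<in>W. a i * c i w * F w v)"
      by (simp add: sum_distrib_left mult.assoc)
    also have "\<dots> = (\<Sum>w\<in>W. (\<Sum>i\<in>I. a i * c i w) * F w v)"
      by (subst sum.swap) (simp add: sum_distrib_right)
    finally show ?thesis .
  qed
  then show ?thesis unfolding spanned_on_def by (intro exI[of _ "\<lambda>w. \<Sum>i\<in>I. a i * c i w"]) auto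
qed

text \<open>Point indicators are linearly independent, and here they lie in the span of at most
  \<open>card W\<close> functions.\<close>

lemma card_le_if_indicators_spanned:
  fixes F :: "'w \<Rightarrow> 'a \<Rightarrow> real"
  assumes "finite V" "finite W"
    and span: "\<And>u. u \<in> V \<Longrightarrow> spanned_on V F W (\<lambda>v. of_bool (v = u))"
  shows "card V \<le> card W"
proof -
  \<comment> \<open>Extension by zero turns equalities on \<open>V\<close> into equalities of
    functions.\<close>
  define G where "G w = (\<lambda>x. if x \<in> V then F w x else 0)" for w
  define \<delta> :: "'a \<Rightarrow> 'a \<Rightarrow> real" where "\<delta> u = (\<lambda>x. of_bool (x = u))" for u
  have inj: "inj_on \<delta> V"
  proof (rule inj_onI)
    fix u v assume "\<delta> u = \<delta> v"
    then have "\<delta> u u = \<delta> v u" by simp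
    then show "u = v" by (auto simp: \<delta>_def)
  qed
  have "\<delta> ` V \<subseteq> fun_space.span (G ` W)"
  proof safe
    fix u assume u: "u \<in> V"
    obtain c where c: "\<forall>v\<in>V. of_bool (v = u) = (\<Sum>w\<in>W. c w * F w v)"
      using span[OF u] unfolding spanned_on_def by blast
    have "\<delta> u = (\<Sum>w\<in>W. (\<lambda>x. c w * G w x))"
    proof
      fix x
      show "\<delta> u x = (\<Sum>w\<in>W. (\<lambda>x. c w * G w x)) x"
        using c u by (cases "x \<in> V") (auto simp: sum_fun_apply \<delta>_def G_def)
    qed
    also have "\<dots> \<in> fun_space.span (G ` W)"
      by (intro fun_space.span_sum fun_space.span_scale fun_space.span_base) auto
    finally show "\<delta> u \<in> fun_space.span (G ` W)" .
  qed
  moreover have "fun_space.independent (\<delta> ` V)"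
  proof -
    have "c (\<delta> u) = 0" if u: "u \<in> V" and *: "(\<Sum>f\<in>\<delta> ` V. (\<lambda>x. c f * f x)) = 0" for c u
    proof -
      \<comment> \<open>Evaluating the relation at \<open>u\<close> isolates the coefficient of
        \<open>\<delta> u\<close>.\<close>
      have "0 = (\<Sum>f\<in>\<delta> ` V. (\<lambda>x. c f * f x)) u" using * by simp
      also have "\<dots> = (\<Sum>v\<in>V. c (\<delta> v) * \<delta> v u)"
        by (simp add: sum_fun_apply sum.reindex[OF inj])
      also have "\<dots> = (\<Sum>v\<in>V. if u = v then c (\<delta> v) else 0)"
        by (intro sum.cong) (auto simp: \<delta>_def)
      also have "\<dots> = c (\<delta> u)" using u \<open>finite V\<close> by simp
      finally show ?thesis by simp
    qed
    then show ?thesis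
      using \<open>finite V\<close> by (auto simp: fun_space.dependent_finite)
  qed
  ultimately have "card (\<delta> ` V) \<le> card (G ` W)"
    using fun_space.independent_span_bound[of "G ` W" "\<delta> ` V"] \<open>finite W\<close> by blast
  also have "\<dots> \<le> card W" using \<open>finite W\<close> by (rule card_image_le)
  finally show ?thesis using card_image[OF inj] by simp
qed

section \<open>The basis on one coordinate\<close>

text \<open>All functions \<open>basis_fun q k\<close> with \<open>k < q\<close> except \<open>k = q - 1\<close> lie in the kernel of
  \<open>h \<mapsto> h 1 + \<dots> + h (q - 1) - (q - 1) * h 0\<close>, which contains no indicator
  of a point; hence the coefficient of \<open>basis_fun q (q - 1)\<close> in such an indicator is nonzero.\<close>

definition basis_fun :: "nat \<Rightarrow> nat \<Rightarrow> nat \<Rightarrow> real" where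
  "basis_fun q k x =
     (if k = 0 then 1
      else if k = q - 1 then of_bool (x = 0)
      else of_bool (x = k) - of_bool (x = q - 1))"

lemma indicator_basis_expansion:
  assumes "q \<ge> 2" "j < q"
  obtains c where "c (q - 1) \<noteq> 0"
    "\<And>x. x < q \<Longrightarrow> (\<Sum>k\<in>{0..<q}. c k * basis_fun q k x) = of_bool (x = j)"
proof (cases "j = 0")
  case True
  show ?thesis
  proof (rule that[of "\<lambda>k. of_bool (k = q - 1)"])
    fix x assume "x < q"
    have "(\<Sum>k\<in>{0..<q}. of_bool (k = q - 1) * basis_fun q k x)
        = (\<Sum>k\<in>{0..<q}. if q - 1 = k then basis_fun q k x else 0)"
      by (intro sum.cong) auto
    also have "\<dots> = of_bool (x = j)"
      using assms True by (simp add: basis_fun_def)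
    finally show "(\<Sum>k\<in>{0..<q}. of_bool (k = q - 1) * basis_fun q k x) = of_bool (x = j)" .
  qed simp
next
  case False
  \<comment> \<open>The differences \<open>[x = k] - [x = q - 1]\<close> sum to
    \<open>1 - z - (q - 1) * [x = q - 1]\<close>. Hence \<open>[x = q - 1]\<close> is
    \<open>a\<close> times \<open>1 - z\<close> minus that sum, and adding the difference with
    \<open>k = j\<close> gives \<open>[x = j]\<close> for \<open>j < q - 1\<close>.\<close>
  define a :: real where "a = 1 / (real q - 1)"
  have q1: "real q - 1 \<noteq> 0" using assms by simp
  then have a: "a \<noteq> 0" by (simp add: a_def)
  have "a + (real q - 2) * a = (real q - 1) * a" by algebra
  also have "\<dots> = 1" using q1 by (simp add: a_def)
  finally have a_sum: "a + (real q - 2) * a = 1" .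
  define c where "c k = (if k = 0 then a else if k = q - 1 then - a else of_bool (k = j) - a)" for k
  show ?thesis
  proof (rule that[of c])
    show "c (q - 1) \<noteq> 0" using a assms by (simp add: c_def)
    fix x assume x: "x < q"
    have split: "{0..<q} = insert 0 (insert (q - 1) {1..<q - 1})" using assms by auto
    have "(\<Sum>k\<in>{0..<q}. c k * basis_fun q k x)
        = a - a * of_bool (x = 0)
          + (\<Sum>k\<in>{1..<q - 1}. (of_bool (k = j) - a) * (of_bool (x = k) - of_bool (x = q - 1)))"
      unfolding split using assms by (simp add: c_def basis_fun_def)
    also have "\<dots> = of_bool (x = j)"
    proof -
      consider "x = 0" | "x = q - 1" "x \<noteq> 0" | "x \<noteq> 0" "x < q - 1" using x by linarith
      then show ?thesis
      proof cases
        case 1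
        then show ?thesis using False assms by simp
      next
        case 2
        have "(\<Sum>k\<in>{1..<q - 1}. (of_bool (k = j) - a) * (of_bool (x = k) - of_bool (x = q - 1)))
            = (\<Sum>k\<in>{1..<q - 1}. a - (if k = j then 1 else 0))"
          using 2 by (intro sum.cong) auto
        also have "\<dots> = (real q - 2) * a - of_bool (j < q - 1)"
          using False assms by (simp add: sum_subtractf of_nat_diff)
        finally show ?thesis using 2 a_sum assms by auto
      next
        case 3
        have "(\<Sum>k\<in>{1..<q - 1}. (of_bool (k = j) - a) * (of_bool (x = k) - of_bool (x = q - 1)))
            = (\<Sum>k\<in>{1..<q - 1}. if k = x then of_bool (k = j) - a else 0)"
          using 3 by (intro sum.cong) auto
        also have "\<dots> = of_bool (x = j) - a" using 3 by simp
        finally show ?thesis using 3 by simp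
      qed
    qed
    finally show "(\<Sum>k\<in>{0..<q}. c k * basis_fun q k x) = of_bool (x = j)" .
  qed
qed

section \<open>Product monomials on tuples\<close>

definition mon :: "nat \<Rightarrow> nat \<Rightarrow> (nat \<Rightarrow> nat) \<Rightarrow> (nat \<Rightarrow> nat) \<Rightarrow> real" where
  "mon q n m v = (\<Prod>i\<in>{1..n}. basis_fun q (m i) (v i))"

text \<open>\<open>q - 1\<close> is the code of the indicator of \<open>0\<close> in
  \<open>basis_fun\<close>, so these are the coordinates with a factor \<open>z\<close>.\<close>

definition top_set :: "nat \<Rightarrow> nat \<Rightarrow> (nat \<Rightarrow> nat) \<Rightarrow> nat set" where
  "top_set q n m = {i \<in> {1..n}. m i = q - 1}"

definition mid_set :: "nat \<Rightarrow> nat \<Rightarrow> (nat \<Rightarrow> nat) \<Rightarrow> nat set" where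
  "mid_set q n m = {i \<in> {1..n}. m i \<noteq> 0 \<and> m i \<noteq> q - 1}"

text \<open>Requiring exactly \<open>s\<close> zero indicators, not at most \<open>s\<close>, yields
  the single factor \<open>n choose s\<close>.\<close>

definition standard_mons :: "nat \<Rightarrow> nat \<Rightarrow> nat \<Rightarrow> nat \<Rightarrow> (nat \<Rightarrow> nat) set" where
  "standard_mons q n d s =
     {m \<in> tuples q n. card (top_set q n m) = s \<and> card (mid_set q n m) \<le> d}"

lemma finite_tuples: "finite (tuples q n)"
  unfolding tuples_def by (intro finite_PiE) auto

lemma finite_standard_mons: "finite (standard_mons q n d s)"
  by (rule finite_subset[OF _ finite_tuples[of q n]]) (auto simp: standard_mons_def)

lemma finite_top_set: "finite (top_set q n m)"
  by (simp add: top_set_def)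

text \<open>Choosing one summand in each coordinate amounts to choosing a tuple
  \<open>r\<close>.\<close>

lemma prod_basis_expansion:
  "(\<Prod>i\<in>{1..n}. \<Sum>k\<in>{0..<q}. c i k * basis_fun q k (v i))
     = (\<Sum>r\<in>tuples q n. (\<Prod>i\<in>{1..n}. c i (r i)) * mon q n r v)"
  unfolding tuples_def mon_def
  by (subst prod_sum_PiE) (simp_all add: prod.distrib)

text \<open>A difference of indicators of two nonzero points vanishes at \<open>0\<close>.\<close>

lemma basis_fun_mid_nonzero:
  assumes "q \<ge> 2" "k \<noteq> 0" "k \<noteq> q - 1" "basis_fun q k x \<noteq> 0"
  shows "x \<noteq> 0"
  using assms by (cases "x = 0") (auto simp: basis_fun_def)

lemma mon_nonzero_factor:
  assumes "mon q n m v \<noteq> 0" "i \<in> {1..n}"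
  shows "basis_fun q (m i) (v i) \<noteq> 0"
  using assms unfolding mon_def by (metis finite_atLeastAtMost prod_zero_iff)

lemma mon_nonzero_mid_set:
  assumes "q \<ge> 2" "mon q n m v \<noteq> 0"
  shows "mid_set q n m \<subseteq> {i \<in> {1..n}. v i \<noteq> 0}"
  using mon_nonzero_factor[OF assms(2)] basis_fun_mid_nonzero[OF assms(1)]
  by (fastforce simp: mid_set_def)

lemma mon_nonzero_top_set:
  assumes "q \<ge> 2" "mon q n m v \<noteq> 0"
  shows "top_set q n m \<subseteq> {i \<in> {1..n}. v i = 0}"
  using mon_nonzero_factor[OF assms(2)] assms(1)
  by (fastforce simp: top_set_def basis_fun_def split: if_splits)

text \<open>Where the monomial does not vanish, \<open>mid_set\<close> lies inside the support of
  \<open>v\<close>, which has only \<open>d\<close> elements.\<close>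

lemma mon_eq_0_if_mid_set_large:
  assumes "q \<ge> 2" "card {i \<in> {1..n}. v i \<noteq> 0} = d" "card (mid_set q n m) > d"
  shows "mon q n m v = 0"
  using assms mon_nonzero_mid_set[of q n m v] card_mono[of "{i \<in> {1..n}. v i \<noteq> 0}" "mid_set q n m"]
  by fastforce

section \<open>Raising the number of zero indicators\<close>

lemma mon_update_top:
  assumes "q \<ge> 2" "j \<in> {1..n}" "m j = 0"
  shows "mon q n (m(j := q - 1)) v = of_bool (v j = 0) * mon q n m v"
proof -
  have *: "mon q n r v = basis_fun q (r j) (v j) * (\<Prod>i\<in>{1..n} - {j}. basis_fun q (r i) (v i))" for r
    unfolding mon_def using assms(2) by (intro prod.remove) auto
  have "(\<Prod>i\<in>{1..n} - {j}. basis_fun q ((m(j := q - 1)) i) (v i))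
      = (\<Prod>i\<in>{1..n} - {j}. basis_fun q (m i) (v i))"
    by (intro prod.cong) auto
  then show ?thesis
    unfolding *[of "m(j := q - 1)"] *[of m] using assms by (simp add: basis_fun_def)
qed

text \<open>The number of zeros of a tuple of Hamming weight \<open>d\<close> is \<open>n - d\<close>; those lying in \<open>top_set\<close> are
  already accounted for by the monomial itself.\<close>

lemma sum_mon_update_top:
  assumes q: "q \<ge> 2" and d: "card {i \<in> {1..n}. v i \<noteq> 0} = d"
  shows "(\<Sum>j\<in>{j \<in> {1..n}. m j = 0}. mon q n (m(j := q - 1)) v)
       = (real n - real d - real (card (top_set q n m))) * mon q n m v"
proof (cases "mon q n m v = 0")
  case True
  then show ?thesis using mon_update_top[OF q, of _ n m v] by simp
next
  case False
  let ?N = "{j \<in> {1..n}. m j = 0 \<and> v j = 0}" and ?D = "{i \<in> {1..n}. v i \<noteq> 0}"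
  have mid: "mid_set q n m \<subseteq> ?D" and top: "top_set q n m \<subseteq> {i \<in> {1..n}. v i = 0}"
    using mon_nonzero_mid_set[OF q False] mon_nonzero_top_set[OF q False] by auto
  \<comment> \<open>A zero of \<open>v\<close> is not in \<open>mid_set\<close>, so its coordinate
    carries a factor \<open>z\<close> or is not involved in the monomial.\<close>
  have "{1..n} = ?D \<union> (top_set q n m \<union> ?N)"
    using mid by (auto simp: mid_set_def top_set_def)
  then have "n = card (?D \<union> (top_set q n m \<union> ?N))" by (metis card_atLeastAtMost diff_Suc_1)
  also have "\<dots> = card ?D + card (top_set q n m \<union> ?N)"
    using top by (intro card_Un_disjoint) (auto simp: finite_top_set)
  also have "card (top_set q n m \<union> ?N) = card (top_set q n m) + card ?N"
    using q by (intro card_Un_disjoint) (auto simp: finite_top_set top_set_def)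
  finally have N: "real (card ?N) = real n - real d - real (card (top_set q n m))"
    using d by simp
  have "(\<Sum>j\<in>{j \<in> {1..n}. m j = 0}. mon q n (m(j := q - 1)) v)
      = (\<Sum>j\<in>{j \<in> {1..n}. m j = 0}. of_bool (v j = 0) * mon q n m v)"
    using mon_update_top[OF q] by (intro sum.cong) auto
  also have "\<dots> = (\<Sum>j\<in>{j \<in> {1..n}. m j = 0}. of_bool (v j = 0)) * mon q n m v"
    by (simp add: sum_distrib_right)
  also have "(\<Sum>j\<in>{j \<in> {1..n}. m j = 0}. of_bool (v j = 0) :: real)
      = real (card ({j \<in> {1..n}. m j = 0} \<inter> {j. v j = 0}))"
    by (rule sum_of_bool_eq) (rule finite_subset[of _ "{1..n}"], auto)
  also have "{j \<in> {1..n}. m j = 0} \<inter> {j. v j = 0} = ?N" by auto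
  finally show ?thesis unfolding N .
qed

text \<open>Induction on the deficit \<open>s - card (top_set q n m)\<close>. At deficit
  \<open>0\<close> the monomial is standard, or its \<open>mid_set\<close> is too large and it
  vanishes on \<open>V\<close>.\<close>

lemma mon_spanned_if_top_set_small:
  assumes q: "q \<ge> 2" and ds: "d + s \<le> n" and ham: "hamming_system n d V"
    and m: "m \<in> tuples q n" and le: "card (top_set q n m) \<le> s"
  shows "spanned_on V (mon q n) (standard_mons q n d s) (mon q n m)"
  using m le
proof (induction "s - card (top_set q n m)" arbitrary: m rule: less_induct)
  case less
  have d: "card {i \<in> {1..n}. v i \<noteq> 0} = d" if "v \<in> V" for v
    using ham that by (simp add: hamming_system_def)
  show ?case
  proof (cases "card (top_set q n m) = s")
    case True
    show ?thesis
    proof (cases "card (mid_set q n m) \<le> d")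
      case True
      then show ?thesis
        using less.prems \<open>card (top_set q n m) = s\<close> finite_standard_mons
        by (intro spanned_on_base) (auto simp: standard_mons_def)
    next
      case False
      then have "mon q n m v = 0" if "v \<in> V" for v
        using mon_eq_0_if_mid_set_large[OF q d[OF that]] by simp
      then show ?thesis
        unfolding spanned_on_def by (intro exI[of _ "\<lambda>_. 0"]) simp
    qed
  next
    case False
    define a where "a = real n - real d - real (card (top_set q n m))"
    \<comment> \<open>Positive, because \<open>card (top_set q n m) < s\<close> and
      \<open>s \<le> n - d\<close>; this is what \<open>d + s \<le> n\<close> is for.\<close>
    have a: "a \<noteq> 0" using False less.prems ds by (simp add: a_def)
    have "spanned_on V (mon q n) (standard_mons q n d s) (mon q n (m(j := q - 1)))"
      if j: "j \<in> {j \<in> {1..n}. m j = 0}" for j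
    proof -
      have "top_set q n (m(j := q - 1)) = insert j (top_set q n m)" "j \<notin> top_set q n m"
        using j q by (auto simp: top_set_def)
      then have "card (top_set q n (m(j := q - 1))) = Suc (card (top_set q n m))"
        by (simp add: finite_top_set)
      moreover have "m(j := q - 1) \<in> tuples q n"
        using j less.prems q by (auto simp: tuples_def PiE_iff extensional_def)
      ultimately show ?thesis
        using False less.prems by (intro less.hyps) auto
    qed
    then have "spanned_on V (mon q n) (standard_mons q n d s)
        (\<lambda>v. \<Sum>j\<in>{j \<in> {1..n}. m j = 0}. (1 / a) * mon q n (m(j := q - 1)) v)"
      by (rule spanned_on_sum)
    then show ?thesis
    proof (rule spanned_on_cong)
      fix v assume "v \<in> V"
      then show "mon q n m v = (\<Sum>j\<in>{j \<in> {1..n}. m j = 0}. (1 / a) * mon q n (m(j := q - 1)) v)"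
        using sum_mon_update_top[OF q d, of v m] a
        by (simp add: sum_divide_distrib[symmetric] a_def[symmetric])
    qed
  qed
qed

section \<open>Lowering the number of zero indicators by missing patterns\<close>

text \<open>Restrictions of members of \<open>V\<close> to \<open>S\<close> always have values below
  \<open>q\<close>, so shattering can only fail through a missed function.\<close>

lemma not_shattered_pattern:
  assumes "V \<subseteq> tuples q n" "S \<subseteq> {1..n}" "\<not> shatters q V S"
  obtains f where "\<And>i. i \<in> S \<Longrightarrow> f i < q" "\<And>v. v \<in> V \<Longrightarrow> \<exists>i\<in>S. v i \<noteq> f i"
proof -
  have "(\<lambda>v. restrict v S) ` V \<subseteq> (S \<rightarrow>\<^sub>E {0..<q})"
    using assms(1,2) by (fastforce simp: tuples_def PiE_iff)
  then obtain f where f: "f \<in> S \<rightarrow>\<^sub>E {0..<q}" "f \<notin> (\<lambda>v. restrict v S) ` V"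
    using assms(3) unfolding shatters_def by blast
  have "\<exists>i\<in>S. v i \<noteq> f i" if "v \<in> V" for v
  proof (rule ccontr)
    assume "\<not> ?thesis"
    then have "restrict v S = f" using f(1) by (auto simp: fun_eq_iff PiE_iff extensional_def)
    then show False using f(2) that by blast
  qed
  then show ?thesis using that[of f] f(1) by (auto simp: PiE_iff)
qed

text \<open>If \<open>top_set\<close> contains a set \<open>S\<close> that is not shattered, the product of the indicators of a missing
  pattern on \<open>S\<close> with the remaining factors of the monomial vanishes on \<open>V\<close>. Expanding it, the monomial
  itself has nonzero coefficient and all others have strictly smaller \<open>top_set\<close>.\<close>

lemma mon_spanned_reduce:
  assumes q: "q \<ge> 2" and V: "V \<subseteq> tuples q n"
    and m: "m \<in> tuples q n" and S: "S \<subseteq> top_set q n m" "\<not> shatters q V S"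
    and IH: "\<And>r. r \<in> tuples q n \<Longrightarrow> top_set q n r \<subset> top_set q n m \<Longrightarrow> spanned_on V (mon q n) W (mon q n r)"
  shows "spanned_on V (mon q n) W (mon q n m)"
proof -
  have Sn: "S \<subseteq> {1..n}" using S(1) by (auto simp: top_set_def)
  obtain f where f: "\<And>i. i \<in> S \<Longrightarrow> f i < q" "\<And>v. v \<in> V \<Longrightarrow> \<exists>i\<in>S. v i \<noteq> f i"
    using not_shattered_pattern[OF V Sn S(2)] by blast
  have "\<forall>i\<in>S. \<exists>c. c (q - 1) \<noteq> 0 \<and>
      (\<forall>x<q. (\<Sum>k\<in>{0..<q}. c k * basis_fun q k x) = of_bool (x = f i))"
  proof
    fix i assume "i \<in> S"
    then show "\<exists>c. c (q - 1) \<noteq> 0 \<and>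
        (\<forall>x<q. (\<Sum>k\<in>{0..<q}. c k * basis_fun q k x) = of_bool (x = f i))"
      by (rule indicator_basis_expansion[OF q f(1)]) blast
  qed
  from bchoice[OF this] obtain c where c: "\<And>i. i \<in> S \<Longrightarrow> c i (q - 1) \<noteq> 0"
    "\<And>i x. i \<in> S \<Longrightarrow> x < q \<Longrightarrow> (\<Sum>k\<in>{0..<q}. c i k * basis_fun q k x) = of_bool (x = f i)"
    by blast
  \<comment> \<open>On \<open>S\<close> the expansion of the indicator of \<open>f i\<close>;
    elsewhere a unit vector keeping the factor of \<open>m\<close>, so the whole product expands
    over tuples.\<close>
  define e where "e i k = (if i \<in> S then c i k else of_bool (k = m i))" for i k
  define C where "C r = (\<Prod>i\<in>{1..n}. e i (r i))" for r
  \<comment> \<open>The factors are \<open>c i (q - 1)\<close> on \<open>S\<close>, because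
    \<open>S\<close> lies in \<open>top_set\<close>, and \<open>1\<close> elsewhere.\<close>
  have Cm: "C m \<noteq> 0"
    using c(1) S(1) by (auto simp: C_def e_def top_set_def)
  \<comment> \<open>A nonzero coefficient forces \<open>r\<close> to agree with \<open>m\<close> off
    \<open>S\<close>. On \<open>S\<close> every entry of \<open>m\<close> is \<open>q - 1\<close>,
    so a difference there can only remove coordinates from \<open>top_set\<close>.\<close>
  have smaller: "top_set q n r \<subset> top_set q n m" if r: "r \<in> tuples q n" "r \<noteq> m" "C r \<noteq> 0" for r
  proof -
    have "e i (r i) \<noteq> 0" if "i \<in> {1..n}" for i
      using r(3) that by (auto simp: C_def)
    then have eq: "r i = m i" if "i \<in> {1..n}" "i \<notin> S" for i
      using that by (fastforce simp: e_def)
    have "\<exists>i\<in>{1..n}. r i \<noteq> m i"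
      using r(1,2) m unfolding tuples_def by (metis PiE_ext)
    then obtain i where i: "i \<in> {1..n}" "r i \<noteq> m i" by blast
    then have "i \<in> S" using eq by blast
    then have "i \<in> top_set q n m" "i \<notin> top_set q n r" using S(1) i by (auto simp: top_set_def)
    moreover have "top_set q n r \<subseteq> top_set q n m"
    proof
      fix j assume "j \<in> top_set q n r"
      then show "j \<in> top_set q n m"
        using eq[of j] S(1) by (cases "j \<in> S") (auto simp: top_set_def)
    qed
    ultimately show ?thesis by blast
  qed
  have zero: "(\<Sum>r\<in>tuples q n. C r * mon q n r v) = 0" if v: "v \<in> V" for v
  proof -
    obtain i where i: "i \<in> S" "v i \<noteq> f i" using f(2)[OF v] by blast
    then have "v i < q" using v V Sn unfolding tuples_def by (meson PiE_mem atLeastLessThan_iff subsetD)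
    then have "(\<Sum>k\<in>{0..<q}. e i k * basis_fun q k (v i)) = 0"
      using c(2)[of i "v i"] i by (simp add: e_def)
    then have "(\<Prod>i\<in>{1..n}. \<Sum>k\<in>{0..<q}. e i k * basis_fun q k (v i)) = 0"
      using i Sn by (intro prod_zero) auto
    then show ?thesis unfolding prod_basis_expansion C_def .
  qed
  have "spanned_on V (mon q n) W (\<lambda>v. \<Sum>r\<in>tuples q n - {m}. (- C r / C m) * mon q n r v)"
    using smaller by (intro spanned_on_sum IH) auto
  then show ?thesis
  proof (rule spanned_on_cong)
    fix v assume "v \<in> V"
    then have "C m * mon q n m v + (\<Sum>r\<in>tuples q n - {m}. C r * mon q n r v) = 0"
      using zero[of v] sum.remove[OF finite_tuples m, of "\<lambda>r. C r * mon q n r v"] by simp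
    moreover have "(\<Sum>r\<in>tuples q n - {m}. (- C r / C m) * mon q n r v)
        = - (\<Sum>r\<in>tuples q n - {m}. C r * mon q n r v) / C m"
      by (simp add: sum_negf sum_divide_distrib)
    ultimately show "mon q n m v = (\<Sum>r\<in>tuples q n - {m}. (- C r / C m) * mon q n r v)"
      using Cm by (metis eq_neg_iff_add_eq_0 nonzero_mult_div_cancel_left)
  qed
qed

text \<open>Strong induction downwards while more than \<open>s\<close> zero indicators occur; from
  \<open>s\<close> on the raising lemma takes over. Raising never exceeds \<open>s\<close>, so the
  two directions do not form a cycle.\<close>

lemma mon_spanned:
  assumes q: "q \<ge> 2" and ds: "d + s \<le> n" and V: "V \<subseteq> tuples q n" and ham: "hamming_system n d V"
    and sh: "\<not> (\<exists>S. S \<subseteq> {1..n} \<and> card S = s + 1 \<and> shatters q V S)"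
    and m: "m \<in> tuples q n"
  shows "spanned_on V (mon q n) (standard_mons q n d s) (mon q n m)"
  using m
proof (induction "card (top_set q n m)" arbitrary: m rule: less_induct)
  case less
  show ?case
  proof (cases "card (top_set q n m) \<le> s")
    case True
    then show ?thesis using mon_spanned_if_top_set_small[OF q ds ham less.prems] by blast
  next
    case False
    then obtain S where S: "S \<subseteq> top_set q n m" "card S = s + 1"
      using obtain_subset_with_card_n[of "s + 1" "top_set q n m"] by auto
    then have "\<not> shatters q V S" using sh unfolding top_set_def by blast
    with S(1) show ?thesis
    proof (rule mon_spanned_reduce[OF q V less.prems])
      fix r assume "r \<in> tuples q n" "top_set q n r \<subset> top_set q n m"
      then show "spanned_on V (mon q n) (standard_mons q n d s) (mon q n r)"
        by (intro less.hyps psubset_card_mono finite_top_set)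
    qed
  qed
qed

section \<open>Point indicators as combinations of monomials\<close>

text \<open>The indicator of a tuple is the product of the indicators of its entries, each of which
  expands in the basis.\<close>

lemma indicator_sum_mon:
  assumes q: "q \<ge> 2" and u: "u \<in> tuples q n"
  obtains c where "\<And>v. v \<in> tuples q n \<Longrightarrow> of_bool (v = u) = (\<Sum>m\<in>tuples q n. c m * mon q n m v)"
proof -
  have "\<forall>i\<in>{1..n}. \<exists>c. \<forall>x<q. (\<Sum>k\<in>{0..<q}. c k * basis_fun q k x) = of_bool (x = u i)"
  proof
    fix i assume "i \<in> {1..n}"
    then have "u i < q" using u by (auto simp: tuples_def PiE_iff)
    then show "\<exists>c. \<forall>x<q. (\<Sum>k\<in>{0..<q}. c k * basis_fun q k x) = of_bool (x = u i)"
      by (rule indicator_basis_expansion[OF q]) blast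
  qed
  from bchoice[OF this] obtain c where c: "\<And>i x. i \<in> {1..n} \<Longrightarrow> x < q \<Longrightarrow>
      (\<Sum>k\<in>{0..<q}. c i k * basis_fun q k x) = of_bool (x = u i)"
    by blast
  show ?thesis
  proof (rule that)
    fix v assume v: "v \<in> tuples q n"
    have "v = u \<longleftrightarrow> (\<forall>i\<in>{1..n}. v i = u i)"
      using u v unfolding tuples_def by (metis PiE_ext)
    then have "of_bool (v = u) = (\<Prod>i\<in>{1..n}. of_bool (v i = u i) :: real)"
      by (auto intro!: prod.neutral)
    also have "\<dots> = (\<Prod>i\<in>{1..n}. \<Sum>k\<in>{0..<q}. c i k * basis_fun q k (v i))"
      using v by (intro prod.cong refl c[symmetric]) (auto simp: tuples_def PiE_iff)
    finally show "of_bool (v = u) = (\<Sum>m\<in>tuples q n. (\<Prod>i\<in>{1..n}. c i (m i)) * mon q n m v)"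
      unfolding prod_basis_expansion .
  qed
qed

section \<open>Counting the standard monomials\<close>

text \<open>Subsets are grouped by size. With \<open>b = q - 2\<close> this counts the choices of a
  \<open>mid_set\<close> together with its labels.\<close>

lemma sum_power_card_subsets:
  fixes A :: "'a set" and b :: nat
  assumes "finite A"
  shows "(\<Sum>T\<in>{T. T \<subseteq> A \<and> card T \<le> d}. b ^ card T) = (\<Sum>i=0..d. (card A choose i) * b ^ i)"
proof -
  have "(\<Sum>T\<in>{T. T \<subseteq> A \<and> card T \<le> d}. b ^ card T)
      = (\<Sum>i=0..d. \<Sum>T\<in>{T \<in> {T. T \<subseteq> A \<and> card T \<le> d}. card T = i}. b ^ card T)"
    using assms by (intro sum.group[symmetric]) auto
  also have "\<dots> = (\<Sum>i=0..d. (card A choose i) * b ^ i)"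
  proof (intro sum.cong refl)
    fix i assume "i \<in> {0..d}"
    then have "{T \<in> {T. T \<subseteq> A \<and> card T \<le> d}. card T = i} = {T. T \<subseteq> A \<and> card T = i}" by auto
    then show "(\<Sum>T\<in>{T \<in> {T. T \<subseteq> A \<and> card T \<le> d}. card T = i}. b ^ card T) = (card A choose i) * b ^ i"
      using n_subsets[OF assms, of i] by simp
  qed
  finally show ?thesis .
qed

text \<open>A monomial is determined by its \<open>top_set\<close>, its \<open>mid_set\<close> and
  its labels on the latter, since every other coordinate has label \<open>0\<close>.\<close>

lemma card_standard_mons_le:
  assumes q: "q \<ge> 2"
  shows "card (standard_mons q n d s) \<le> (n choose s) * (\<Sum>i=0..d. ((n - s) choose i) * (q - 2) ^ i)"
proof -
  define P where "P = (SIGMA Z:{Z. Z \<subseteq> {1..n} \<and> card Z = s}.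
      SIGMA T:{T. T \<subseteq> {1..n} - Z \<and> card T \<le> d}. T \<rightarrow>\<^sub>E {1..<q - 1})"
  define \<phi> where "\<phi> m = (top_set q n m, mid_set q n m, restrict m (mid_set q n m))" for m
  have finT: "finite T" if "T \<subseteq> {1..n} - Z" for T Z :: "nat set"
    using that by (rule finite_subset) simp
  have finP: "finite (SIGMA T:{T. T \<subseteq> {1..n} - Z \<and> card T \<le> d}. T \<rightarrow>\<^sub>E {1..<q - 1})" for Z
    by (intro finite_SigmaI finite_PiE) (use finT in auto)
  have "inj_on \<phi> (standard_mons q n d s)"
  proof (rule inj_onI)
    fix m r assume m: "m \<in> standard_mons q n d s" "r \<in> standard_mons q n d s" and eq: "\<phi> m = \<phi> r"
    have top: "top_set q n m = top_set q n r" and mid: "mid_set q n m = mid_set q n r"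
      and res: "restrict m (mid_set q n m) = restrict r (mid_set q n m)"
      using eq by (auto simp: \<phi>_def)
    have "m i = r i" if i: "i \<in> {1..n}" for i
    proof (cases "i \<in> mid_set q n m")
      case True
      then show ?thesis using res by (metis restrict_apply')
    next
      case False
      then have "i \<notin> mid_set q n r" "i \<in> top_set q n m \<longleftrightarrow> i \<in> top_set q n r"
        using top mid by simp_all
      with False i show ?thesis by (auto simp: top_set_def mid_set_def)
    qed
    moreover have "m \<in> {1..n} \<rightarrow>\<^sub>E {0..<q}" "r \<in> {1..n} \<rightarrow>\<^sub>E {0..<q}"
      using m by (simp_all add: standard_mons_def tuples_def)
    ultimately show "m = r" by (metis PiE_ext)
  qed
  moreover have "\<phi> ` standard_mons q n d s \<subseteq> P"
  proof
    fix p assume "p \<in> \<phi> ` standard_mons q n d s"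
    then obtain m where m: "m \<in> standard_mons q n d s" "p = \<phi> m" by blast
    have "m i \<in> {1..<q - 1}" if "i \<in> mid_set q n m" for i
    proof -
      have "m i < q"
        using m(1) that by (auto simp: standard_mons_def tuples_def mid_set_def PiE_iff)
      then show ?thesis using that by (auto simp: mid_set_def)
    qed
    then have "restrict m (mid_set q n m) \<in> mid_set q n m \<rightarrow>\<^sub>E {1..<q - 1}"
      by (intro restrict_PiE_iff[THEN iffD2]) blast
    moreover have "top_set q n m \<subseteq> {1..n}" "mid_set q n m \<subseteq> {1..n} - top_set q n m"
      by (auto simp: top_set_def mid_set_def)
    ultimately show "p \<in> P"
      using m by (simp add: \<phi>_def P_def standard_mons_def)
  qed
  moreover have "finite P"
    unfolding P_def by (intro finite_SigmaI finP) simp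
  ultimately have "card (standard_mons q n d s) \<le> card P"
    by (rule card_inj_on_le)
  also have "card P = (\<Sum>Z\<in>{Z. Z \<subseteq> {1..n} \<and> card Z = s}.
      card (SIGMA T:{T. T \<subseteq> {1..n} - Z \<and> card T \<le> d}. T \<rightarrow>\<^sub>E {1..<q - 1}))"
    unfolding P_def using finP by (intro card_SigmaI) auto
  also have "\<dots> = (\<Sum>Z\<in>{Z. Z \<subseteq> {1..n} \<and> card Z = s}. \<Sum>i=0..d. ((n - s) choose i) * (q - 2) ^ i)"
  proof (intro sum.cong refl)
    fix Z assume "Z \<in> {Z. Z \<subseteq> {1..n} \<and> card Z = s}"
    then have Z: "Z \<subseteq> {1..n}" "card Z = s" by auto
    have "card (SIGMA T:{T. T \<subseteq> {1..n} - Z \<and> card T \<le> d}. T \<rightarrow>\<^sub>E {1..<q - 1})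
        = (\<Sum>T\<in>{T. T \<subseteq> {1..n} - Z \<and> card T \<le> d}. card (T \<rightarrow>\<^sub>E {1..<q - 1}))"
      by (intro card_SigmaI) (use finT in \<open>auto intro!: finite_PiE\<close>)
    also have "\<dots> = (\<Sum>T\<in>{T. T \<subseteq> {1..n} - Z \<and> card T \<le> d}. (q - 2) ^ card T)"
    proof (intro sum.cong refl)
      fix T assume "T \<in> {T. T \<subseteq> {1..n} - Z \<and> card T \<le> d}"
      then have "finite T" using finT by blast
      \<comment> \<open>For \<open>q = 2\<close> there are no labels: only \<open>T = {}\<close>
        contributes, in accordance with \<open>0 ^ 0 = 1\<close>.\<close>
      then show "card (T \<rightarrow>\<^sub>E {1..<q - 1}) = (q - 2) ^ card T"
        by (simp add: card_funcsetE numeral_2_eq_2)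
    qed
    also have "\<dots> = (\<Sum>i=0..d. (card ({1..n} - Z) choose i) * (q - 2) ^ i)"
      by (rule sum_power_card_subsets) simp
    also have "card ({1..n} - Z) = n - s"
      using Z by (simp add: card_Diff_subset finite_subset)
    finally show "card (SIGMA T:{T. T \<subseteq> {1..n} - Z \<and> card T \<le> d}. T \<rightarrow>\<^sub>E {1..<q - 1})
        = (\<Sum>i=0..d. ((n - s) choose i) * (q - 2) ^ i)" .
  qed
  also have "\<dots> = (n choose s) * (\<Sum>i=0..d. ((n - s) choose i) * (q - 2) ^ i)"
    using n_subsets[of "{1..n}" s] by simp
  finally show ?thesis .
qed

section \<open>The bound on the tuple system\<close>

theorem theorem5:
  fixes n q d s :: nat and V :: "(nat \<Rightarrow> nat) set"
  assumes "n \<ge> 1" and "q \<ge> 2" and "d \<le> n" and "d + s \<le> n"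
    and "V \<subseteq> tuples q n"
    and "hamming_system n d V"
    and "\<not> (\<exists>S. S \<subseteq> {1..n} \<and> card S = s + 1 \<and> shatters q V S)"
  shows "card V \<le> (n choose s) * (\<Sum>i=0..d. ((n - s) choose i) * (q - 2) ^ i)"
proof -
  have "card V \<le> card (standard_mons q n d s)"
  proof (rule card_le_if_indicators_spanned)
    show "finite V" using assms(5) finite_tuples finite_subset by blast
    show "finite (standard_mons q n d s)" by (rule finite_standard_mons)
    fix u assume "u \<in> V"
    then have "u \<in> tuples q n" using assms(5) by blast
    then obtain c where c: "\<And>v. v \<in> tuples q n \<Longrightarrow>
        of_bool (v = u) = (\<Sum>m\<in>tuples q n. c m * mon q n m v)"
      using indicator_sum_mon[OF assms(2)] by blast
    \<comment> \<open>The indicator of \<open>u\<close> expands over all monomials, and each of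
      these reduces to standard ones on \<open>V\<close>.\<close>
    have "spanned_on V (mon q n) (standard_mons q n d s) (\<lambda>v. \<Sum>m\<in>tuples q n. c m * mon q n m v)"
      using assms(2,4-7) by (intro spanned_on_sum mon_spanned) auto
    then show "spanned_on V (mon q n) (standard_mons q n d s) (\<lambda>v. of_bool (v = u))"
    proof (rule spanned_on_cong)
      fix v assume "v \<in> V"
      then show "of_bool (v = u) = (\<Sum>m\<in>tuples q n. c m * mon q n m v)"
        using c assms(5) by blast
    qed
  qed
  also have "\<dots> \<le> (n choose s) * (\<Sum>i=0..d. ((n - s) choose i) * (q - 2) ^ i)"
    using assms(2) by (rule card_standard_mons_le)
  finally show ?thesis .
qed

end
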